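(* Let $f$ be an indecomposable finite character on the infinite symmetric inverse semigroup $R_\infty$. Let $\rho\in[0,1]$ be the number such that $f(c\cdot\epsilon_{\mathbb{A}})=\rho^{\#({\rm supp}\,c)}$ for every quasicycle $c\cdot\epsilon_{\mathbb{A}}$ with $\mathbb{A}\neq\emptyset$ (in particular $\rho=f(\epsilon_{\{1\}})$), and let $\alpha=\{\alpha_1\geq\alpha_2\geq\ldots>0\}$, $\beta=\{\beta_1\geq\beta_2\geq\ldots>0\}$ be the Thoma parameters of the restriction $\chi_{\alpha\beta}$ of $f$ to $\mathfrak{S}_\infty$. Then $\rho\in\alpha\cup\{0\}$, i.e. either $\rho=0$ or $\rho=\alpha_i$ for some $i$. Moreover, if $\rho=\lambda$, $c=(1\;2\;\ldots\;k)$ and $\mathbb{A}\subset{\rm supp}\,c=\{1,2,\ldots,k\}$, then $$f(c\cdot\epsilon_{\mathbb{A}})=\begin{cases}\lambda^k,&\text{if }\mathbb{A}\neq\emptyset,\\ \chi_{\alpha\beta}(c),&\text{if }\mathbb{A}=\emptyset.\end{cases}$$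
   Context: $R_\infty$ is the semigroup (under matrix multiplication) of all infinite 0-1 matrices $[r_{ij}]_{i,j\in\mathbb{N}}$ with at most one entry 1 in each row and each column and such that $r_{nn}=1$ and all other entries of the $n$th row and column vanish for all sufficiently large $n$. Its involution is transposition, $[r_{ij}]^\star=[r_{ji}]$ (also written $r^*$). The group $\mathfrak{S}_\infty$ of finitely supported permutations of $\mathbb{N}$ is the subgroup of permutation matrices in $R_\infty$. For a finite $\mathbb{A}\subset\mathbb{N}$, $\epsilon_{\mathbb{A}}\in R_\infty$ is the diagonal matrix whose $i$th diagonal entry is $0$ if $i\in\mathbb{A}$ and $1$ if $i\notin\mathbb{A}$. A quasicycle is an element $c\cdot\epsilon_{\mathbb{A}}$, where $c=(n_1\;n_2\;\cdots\;n_k)$ is a cycle in $\mathfrak{S}_\infty$ and $\mathbb{A}\subseteq{\rm supp}\,c=\{n_1,\ldots,n_k\}$; the length $k=1$ is allowed, so that $\epsilon_{\{n\}}$ is a quasicycle, with $c=(n)$ and the convention ${\rm supp}\,c=\{n\}$. An indecomposable finite character on $R_\infty$ is a function $f:R_\infty\to\mathbb{C}$ that is (1) central: $f(rs)=f(sr)$ for all $r,s$; (2) positive definite: for all $r_1,\ldots,r_n\in R_\infty$ the matrix $[f(r_i^*r_j)]$ is Hermitian and non-negative definite; (3) indecomposable: not a sum of two linearly independent functions satisfying (1) and (2); (4) normalized: $f(e)=1$, where $e$ is the identity. It is known that a number $\rho$ as in the claim exists, and that the restriction of $f$ to $\mathfrak{S}_\infty$ is an indecomposable character of $\mathfrak{S}_\infty$.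 By Thoma's theorem there are then unique (finite or infinite, possibly empty) non-increasing sequences $\alpha,\beta$ of positive numbers with $\sum_i\alpha_i+\sum_i\beta_i\leq1$ (the Thoma parameters) such that $f(c)=\sum_i\alpha_i^{l}+(-1)^{l-1}\sum_i\beta_i^{l}$ for every cycle $c\in\mathfrak{S}_\infty$ of length $l>1$, and $f$ is multiplicative over disjoint cycles; $\chi_{\alpha\beta}$ denotes this restriction. *)

theory Defs
  imports Complex_Main "HOL-Library.Groups_Big_Fun" "HOL-Combinatorics.Perm"
begin

section \<open>The infinite symmetric inverse semigroup\<close>

definition is_rinf :: "(nat \<Rightarrow> nat \<Rightarrow> nat) \<Rightarrow> bool" where
  "is_rinf r \<longleftrightarrow>
     (\<forall>i j. r i j \<in> {0, 1}) \<and>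
     (\<forall>i. \<exists>\<^sub>\<le>\<^sub>1 j. r i j = 1) \<and>
     (\<forall>j. \<exists>\<^sub>\<le>\<^sub>1 i. r i j = 1) \<and>
     (\<exists>N. \<forall>n\<ge>N. r n n = 1 \<and> (\<forall>i. i \<noteq> n \<longrightarrow> r n i = 0 \<and> r i n = 0))"

lemma is_rinf_indicator:
  assumes "\<And>i. \<exists>\<^sub>\<le>\<^sub>1 j. Q i j" "\<And>j. \<exists>\<^sub>\<le>\<^sub>1 i. Q i j"
    and "\<exists>N. \<forall>n\<ge>N. Q n n \<and> (\<forall>i. i \<noteq> n \<longrightarrow> \<not> Q n i \<and> \<not> Q i n)"
  shows "is_rinf (\<lambda>i j. if Q i j then 1 else 0)"
proof -
  from assms(3) obtain N where "\<forall>n\<ge>N. Q n n \<and> (\<forall>i. i \<noteq> n \<longrightarrow> \<not> Q n i \<and> \<not> Q i n)"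
    by blast
  then have "\<exists>N. \<forall>n\<ge>N. (if Q n n then 1 else 0) = (1 :: nat) \<and>
      (\<forall>i. i \<noteq> n \<longrightarrow> (if Q n i then 1 else 0) = (0 :: nat) \<and> (if Q i n then 1 else 0) = (0 :: nat))"
    by (intro exI[of _ N]) simp
  with assms(1,2) show ?thesis
    unfolding is_rinf_def by (intro conjI) simp_all
qed

lemma is_rinf_diag:
  assumes "finite A"
  shows "is_rinf (\<lambda>i j. if i = j \<and> i \<notin> A then 1 else 0)"
proof -
  obtain N where "\<forall>n\<in>A. n < N"
    using assms finite_nat_set_iff_bounded by blast
  then have "\<forall>n\<ge>N. n \<notin> A"
    by (auto simp: not_less[symmetric])
  then have "\<exists>N. \<forall>n\<ge>N. (n = n \<and> n \<notin> A) \<and>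
      (\<forall>i. i \<noteq> n \<longrightarrow> \<not> (n = i \<and> n \<notin> A) \<and> \<not> (i = n \<and> i \<notin> A))"
    by (intro exI[of _ N]) simp
  then show ?thesis
    by (intro is_rinf_indicator) (auto simp: Uniq_def)
qed

typedef rinf = "{r. is_rinf r}"
  morphisms entry Abs_rinf
  using is_rinf_diag[of "{}"] by auto

setup_lifting type_definition_rinf

lemma rinf_eqI: "(\<And>i j. entry r i j = 1 \<longleftrightarrow> entry s i j = 1) \<Longrightarrow> r = s"
proof (transfer, intro ext)
  fix r s :: "nat \<Rightarrow> nat \<Rightarrow> nat" and i j
  assume "is_rinf r" "is_rinf s" and eq: "\<And>i j. r i j = 1 \<longleftrightarrow> s i j = 1"
  then have "r i j \<in> {0, 1}" "s i j \<in> {0, 1}"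
    by (simp_all only: is_rinf_def)
  with eq[of i j] show "r i j = s i j" by auto
qed

definition mat_mult :: "(nat \<Rightarrow> nat \<Rightarrow> nat) \<Rightarrow> (nat \<Rightarrow> nat \<Rightarrow> nat) \<Rightarrow> nat \<Rightarrow> nat \<Rightarrow> nat" where
  "mat_mult r s = (\<lambda>i j. Sum_any (\<lambda>k. r i k * s k j))"

lemma mat_mult_eq:
  assumes r: "is_rinf r" and s: "is_rinf s"
  shows "mat_mult r s i j = (if \<exists>k. r i k = 1 \<and> s k j = 1 then 1 else 0)"
proof (cases "\<exists>k. r i k = 1 \<and> s k j = 1")
  case True
  then obtain k where k: "r i k = 1" "s k j = 1" by blast
  have "r i l * s l j = (if l = k then 1 else 0)" for l
    using r s k unfolding is_rinf_def Uniq_def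
    by (metis insertE mult_1 mult_zero_left singletonD)
  then have "mat_mult r s i j = Sum_any (\<lambda>l. if l = k then 1 else 0)"
    by (simp add: mat_mult_def)
  with True show ?thesis by simp
next
  case False
  have "r i l * s l j = 0" for l
    using r s False unfolding is_rinf_def
    by (metis insertE mult_eq_0_iff singletonD)
  then have "mat_mult r s i j = 0"
    by (simp only: mat_mult_def Sum_any.neutral)
  with False show ?thesis by simp
qed

lemma is_rinf_mult:
  assumes r: "is_rinf r" and s: "is_rinf s"
  shows "is_rinf (mat_mult r s)"
proof -
  from r obtain M where M: "\<forall>n\<ge>M. r n n = 1 \<and> (\<forall>i. i \<noteq> n \<longrightarrow> r n i = 0 \<and> r i n = 0)"
    by (auto simp: is_rinf_def)
  from s obtain N where N: "\<forall>n\<ge>N. s n n = 1 \<and> (\<forall>i. i \<noteq> n \<longrightarrow> s n i = 0 \<and> s i n = 0)"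
    by (auto simp: is_rinf_def)
  define Q where "Q i j \<longleftrightarrow> (\<exists>k. r i k = 1 \<and> s k j = 1)" for i j
  have eq: "mat_mult r s = (\<lambda>i j. if Q i j then 1 else 0)"
    by (simp add: fun_eq_iff mat_mult_eq[OF r s] Q_def)
  have row: "\<exists>\<^sub>\<le>\<^sub>1 j. Q i j" for i
    using r s unfolding is_rinf_def Uniq_def Q_def by metis
  have col: "\<exists>\<^sub>\<le>\<^sub>1 i. Q i j" for j
    using r s unfolding is_rinf_def Uniq_def Q_def by metis
  have "Q n n \<and> (\<forall>i. i \<noteq> n \<longrightarrow> \<not> Q n i \<and> \<not> Q i n)" if "n \<ge> max M N" for n
    using that M N unfolding Q_def by (metis max.bounded_iff zero_neq_one)
  then have "\<exists>N. \<forall>n\<ge>N. Q n n \<and> (\<forall>i. i \<noteq> n \<longrightarrow> \<not> Q n i \<and> \<not> Q i n)"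
    by blast
  with row col show ?thesis
    unfolding eq by (rule is_rinf_indicator)
qed

lift_definition rinf_star :: "rinf \<Rightarrow> rinf" is "\<lambda>r i j. r j i"
  by (auto simp: is_rinf_def)

instantiation rinf :: monoid_mult
begin

lift_definition one_rinf :: rinf is "\<lambda>i j. if i = j then 1 else 0"
  using is_rinf_diag[of "{}"] by simp

lift_definition times_rinf :: "rinf \<Rightarrow> rinf \<Rightarrow> rinf" is mat_mult
  by (rule is_rinf_mult)

lemma entry_times_eq_1_iff:
  "entry (r * s) i j = 1 \<longleftrightarrow> (\<exists>k. entry r i k = 1 \<and> entry s k j = 1)"
  by transfer (simp add: mat_mult_eq)

lemma entry_one_eq_1_iff: "entry 1 i j = 1 \<longleftrightarrow> i = j"
  by transfer simp

instance
proof
  fix r s t :: rinf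
  show "r * s * t = r * (s * t)"
    by (rule rinf_eqI) (auto simp only: entry_times_eq_1_iff)
  show "1 * r = r"
    by (rule rinf_eqI) (auto simp only: entry_times_eq_1_iff entry_one_eq_1_iff)
  show "r * 1 = r"
    by (rule rinf_eqI) (auto simp only: entry_times_eq_1_iff entry_one_eq_1_iff)
qed

end

text \<open>Only used for finite \<open>A\<close>; for infinite \<open>A\<close> the value is unspecified.\<close>

definition eps :: "nat set \<Rightarrow> rinf" where
  "eps A = Abs_rinf (\<lambda>i j. if i = j \<and> i \<notin> A then 1 else 0)"

lemma entry_eps:
  "finite A \<Longrightarrow> entry (eps A) i j = (if i = j \<and> i \<notin> A then 1 else 0)"
  unfolding eps_def by (subst Abs_rinf_inverse) (auto intro: is_rinf_diag)

lift_definition perm_matrix :: "nat perm \<Rightarrow> rinf" is "\<lambda>p i j. if i = p j then 1 else 0"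
proof -
  fix p :: "nat \<Rightarrow> nat"
  assume p: "bij p \<and> finite {a. p a \<noteq> a}"
  then obtain N where "\<forall>n\<in>{a. p a \<noteq> a}. n < N"
    using finite_nat_set_iff_bounded by blast
  then have "p n = n" if "n \<ge> N" for n
    using that by (auto simp: not_less[symmetric])
  moreover have "p i = p j \<longleftrightarrow> i = j" for i j
    using p by (simp add: bij_is_inj inj_eq)
  ultimately have "\<exists>N. \<forall>n\<ge>N. n = p n \<and> (\<forall>i. i \<noteq> n \<longrightarrow> n \<noteq> p i \<and> i \<noteq> p n)"
    by (intro exI[of _ N]) metis
  moreover have "\<exists>\<^sub>\<le>\<^sub>1 j. i = p j" "\<exists>\<^sub>\<le>\<^sub>1 i. i = p j" for i j
    using p by (auto simp: Uniq_def bij_is_inj inj_eq)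
  ultimately show "is_rinf (\<lambda>i j. if i = p j then 1 else 0)"
    by (intro is_rinf_indicator)
qed

lemma entry_perm_matrix_eq_1_iff: "entry (perm_matrix p) i j = 1 \<longleftrightarrow> i = apply p j"
  by transfer simp

lemma perm_matrix_1: "perm_matrix 1 = 1"
  by (rule rinf_eqI) (simp only: entry_perm_matrix_eq_1_iff entry_one_eq_1_iff apply_one id_apply)

lemma perm_matrix_times: "perm_matrix (p * q) = perm_matrix p * perm_matrix q"
  by (rule rinf_eqI)
    (auto simp only: entry_perm_matrix_eq_1_iff entry_times_eq_1_iff apply_times comp_apply)

text \<open>
  \<open>cycle [n\<^sub>1, \<dots>, n\<^sub>k]\<close> is the cycle sending each entry of a distinct list to the next one,
  and the identity for \<open>k = 1\<close>.  Since supp \<open>(n) = {n}\<close> by convention, the support of a cycle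
  is the set of entries of the list and not \<^const>\<open>affected\<close>.
\<close>

lemma apply_cycle_notin: "a \<notin> set ns \<Longrightarrow> apply (cycle ns) a = a"
  by (induction ns rule: cycle.induct) (auto simp: apply_times)

lemma apply_cycle_nth:
  "distinct ns \<Longrightarrow> i < length ns \<Longrightarrow> apply (cycle ns) (ns ! i) = ns ! (Suc i mod length ns)"
proof (induction ns arbitrary: i rule: cycle.induct)
  case hyps: (3 a b as)
  have IH: "apply (cycle (a # as)) ((a # as) ! j) = (a # as) ! (Suc j mod Suc (length as))"
    if "j < Suc (length as)" for j
    using hyps that by simp
  have ab: "b \<notin> set (a # as)" "a \<notin> set as"
    using hyps.prems by auto
  consider "i = 0" | "i = 1" | j where "i = Suc (Suc j)" "j < length as"
    using hyps.prems by (cases i; cases "i - 1") auto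
  then show ?case
  proof cases
    case 1
    from apply_cycle_notin[OF ab(1)] show ?thesis using 1 by (simp add: apply_times)
  next
    case 2
    then show ?thesis using IH[of 0] by (cases as) (auto simp: apply_times)
  next
    case (3 j)
    then have "as ! j \<in> set as" by simp
    with ab have "as ! j \<noteq> a" "as ! j \<noteq> b" by auto
    then have "apply (cycle (a # b # as)) ((a # b # as) ! i) = apply (cycle (a # as)) ((a # as) ! Suc j)"
      using 3 by (simp add: apply_times)
    also have "\<dots> = (a # as) ! (Suc (Suc j) mod Suc (length as))"
      using 3 by (intro IH) simp
    also have "\<dots> = (a # b # as) ! (Suc i mod length (a # b # as))"
      using 3 by (cases "Suc j = length as") auto
    finally show ?thesis .
  qed
qed auto


section \<open>Indecomposable finite characters\<close>

definition central :: "(rinf \<Rightarrow> complex) \<Rightarrow> bool" where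
  "central f \<longleftrightarrow> (\<forall>r s. f (r * s) = f (s * r))"

definition hermitian_nonneg :: "nat \<Rightarrow> (nat \<Rightarrow> nat \<Rightarrow> complex) \<Rightarrow> bool" where
  "hermitian_nonneg n M \<longleftrightarrow>
     (\<forall>i<n. \<forall>j<n. M i j = cnj (M j i)) \<and>
     (\<forall>z. 0 \<le> Re (\<Sum>i<n. \<Sum>j<n. cnj (z i) * M i j * z j))"

definition positive_definite :: "(rinf \<Rightarrow> complex) \<Rightarrow> bool" where
  "positive_definite f \<longleftrightarrow>
     (\<forall>n (r :: nat \<Rightarrow> rinf). hermitian_nonneg n (\<lambda>i j. f (rinf_star (r i) * r j)))"

definition linearly_independent_pair :: "('a \<Rightarrow> complex) \<Rightarrow> ('a \<Rightarrow> complex) \<Rightarrow> bool" where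
  "linearly_independent_pair g h \<longleftrightarrow>
     (\<forall>a b. (\<forall>x. a * g x + b * h x = 0) \<longrightarrow> a = 0 \<and> b = 0)"

definition indecomposable :: "(rinf \<Rightarrow> complex) \<Rightarrow> bool" where
  "indecomposable f \<longleftrightarrow>
     \<not> (\<exists>g h. central g \<and> positive_definite g \<and> central h \<and> positive_definite h \<and>
           linearly_independent_pair g h \<and> f = (\<lambda>r. g r + h r))"

definition indecomposable_finite_character :: "(rinf \<Rightarrow> complex) \<Rightarrow> bool" where
  "indecomposable_finite_character f \<longleftrightarrow>
     central f \<and> positive_definite f \<and> indecomposable f \<and> f 1 = 1"


section \<open>Thoma parameters\<close>

text \<open>
  A finite or infinite, possibly empty, non-increasing sequence of positive numbers is encoded
  as an infinite non-increasing sequence of nonnegative numbers, padding a finite one with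
  zeros.  The members of the original sequence are the positive values (\<open>terms\<close>), and the
  padding does not contribute to the power sums.
\<close>

definition thoma_sequences :: "(nat \<Rightarrow> real) \<Rightarrow> (nat \<Rightarrow> real) \<Rightarrow> bool" where
  "thoma_sequences \<alpha> \<beta> \<longleftrightarrow>
     decseq \<alpha> \<and> decseq \<beta> \<and> (\<forall>i. 0 \<le> \<alpha> i) \<and> (\<forall>i. 0 \<le> \<beta> i) \<and>
     summable \<alpha> \<and> summable \<beta> \<and> suminf \<alpha> + suminf \<beta> \<le> 1"

definition terms :: "(nat \<Rightarrow> real) \<Rightarrow> real set" where
  "terms \<alpha> = {\<alpha> i | i. 0 < \<alpha> i}"

definition thoma_cycle_value :: "(nat \<Rightarrow> real) \<Rightarrow> (nat \<Rightarrow> real) \<Rightarrow> nat \<Rightarrow> real" where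
  "thoma_cycle_value \<alpha> \<beta> l = suminf (\<lambda>i. \<alpha> i ^ l) + (-1) ^ (l - 1) * suminf (\<lambda>i. \<beta> i ^ l)"

text \<open>
  The orbits of the affected points are the supports of the cycles of length at least 2 in the
  disjoint cycle decomposition.  Fixed points contribute the factor 1.
\<close>

definition thoma_character :: "(nat \<Rightarrow> real) \<Rightarrow> (nat \<Rightarrow> real) \<Rightarrow> nat perm \<Rightarrow> complex" where
  "thoma_character \<alpha> \<beta> p =
     (\<Prod>C \<in> orbit p ` affected p. of_real (thoma_cycle_value \<alpha> \<beta> (card C)))"

definition thoma_parameters :: "(nat perm \<Rightarrow> complex) \<Rightarrow> (nat \<Rightarrow> real) \<Rightarrow> (nat \<Rightarrow> real) \<Rightarrow> bool" where
  "thoma_parameters \<chi> \<alpha> \<beta> \<longleftrightarrow> thoma_sequences \<alpha> \<beta> \<and> \<chi> = thoma_character \<alpha> \<beta>"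

end

theory Submission
  imports Defs "HOL-Computational_Algebra.Polynomial" "HOL-Library.Nat_Bijection"
begin

text \<open>
  In the GNS representation of \<open>f\<close> with cyclic vector \<open>\<xi>\<close>, let \<open>O\<close> be the weak limit of the
  transpositions \<open>(0 n)\<close>.  Thoma's formula says that the spectral measure of \<open>O\<close> at \<open>\<xi>\<close> has mass
  \<open>\<alpha>\<^sub>i\<close> at \<open>\<alpha>\<^sub>i\<close>, mass \<open>\<beta>\<^sub>i\<close> at \<open>-\<beta>\<^sub>i\<close>, and the remaining mass at 0.  The values of \<open>f\<close> on
  quasicycles say that \<open>P(O)\<xi>\<close> and \<open>\<epsilon>\<xi>\<close> have inner product \<open>\<rho> P(\<rho>)\<close>, where \<open>\<epsilon>\<close> kills the point 0
  and \<open>\<epsilon>\<xi>\<close> has squared norm \<open>\<rho>\<close>.  By Cauchy--Schwarz \<open>\<rho> P(\<rho>)\<^sup>2\<close> is at most the integral of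
  \<open>P\<^sup>2\<close>.  Letting \<open>P\<close> tend to the indicator of \<open>\<rho>\<close> shows that \<open>\<rho>\<close>, if positive, is an atom of the
  spectral measure, hence some \<open>\<alpha>\<^sub>i\<close>.
\<close>

section \<open>Involution, idempotents and products of cycles\<close>

lemma rinf_star_perm_matrix: "rinf_star (perm_matrix p) = perm_matrix (inverse p)"
proof (rule rinf_eqI)
  fix i j
  have "entry (rinf_star (perm_matrix p)) i j = entry (perm_matrix p) j i"
    by (simp add: rinf_star.rep_eq)
  moreover have "j = apply p i \<longleftrightarrow> i = apply (inverse p) j"
    using apply_sequence[of p "inverse p" j] apply_sequence[of "inverse p" p i] by auto
  ultimately show "entry (rinf_star (perm_matrix p)) i j = 1 \<longleftrightarrow>
      entry (perm_matrix (inverse p)) i j = 1"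
    by (simp only: entry_perm_matrix_eq_1_iff)
qed

lemma rinf_star_eps: "finite A \<Longrightarrow> rinf_star (eps A) = eps A"
proof (rule rinf_eqI)
  fix i j
  assume A: "finite A"
  have "entry (rinf_star (eps A)) i j = entry (eps A) j i"
    by (simp add: rinf_star.rep_eq)
  with A show "entry (rinf_star (eps A)) i j = 1 \<longleftrightarrow> entry (eps A) i j = 1"
    by (auto simp: entry_eps)
qed

lemma eps_times_eps: "finite A \<Longrightarrow> eps A * eps A = eps A"
  by (rule rinf_eqI) (simp only: entry_times_eq_1_iff, auto simp: entry_eps)

text \<open>\<open>cycle\<close> is a product of transpositions through the first point, so
  splitting the list splits the product. Read from right to left, this glues two cycles that meet
  only in \<open>a\<close> into a single cycle.\<close>

lemma cycle_Cons_append: "cycle (a # ys @ xs) = cycle (a # xs) * cycle (a # ys)"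
  by (induction ys) (simp_all add: mult.assoc)

text \<open>Keeping \<open>a\<close> in front makes an inverse cycle ready to be glued at
  \<open>a\<close> to another cycle.\<close>

lemma inverse_cycle_Cons: "inverse (cycle (a # xs)) = cycle (a # rev xs)"
proof (induction xs)
  case (Cons b xs)
  have "inverse (cycle (a # b # xs)) = cycle [a, b] * cycle (a # rev xs)"
    using Cons by simp
  then show ?case
    by (simp only: cycle_Cons_append[symmetric]) simp
qed simp

section \<open>Orbits of cycles and Thoma's value on one cycle\<close>

lemma apply_cycle_power_nth:
  assumes "distinct ns" "i < length ns"
  shows "apply (cycle ns ^ n) (ns ! i) = ns ! ((i + n) mod length ns)"
proof (induction n)
  case (Suc n)
  have "(i + n) mod length ns < length ns"
    using assms by (intro mod_less_divisor) auto
  with Suc assms show ?case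
    by (simp add: apply_times apply_cycle_nth mod_Suc_eq)
qed (use assms in simp)

lemma orbit_cycle:
  assumes "distinct ns" "a \<in> set ns"
  shows "orbit (cycle ns) a = set ns"
proof -
  obtain i where i: "i < length ns" "ns ! i = a"
    using assms(2) by (auto simp: in_set_conv_nth)
  have eq: "apply (cycle ns ^ n) a = ns ! ((i + n) mod length ns)" for n
    using apply_cycle_power_nth[OF assms(1) i(1)] i(2) by simp
  show ?thesis
  proof (intro subset_antisym subsetI)
    fix x assume "x \<in> orbit (cycle ns) a"
    then obtain n where "x = ns ! ((i + n) mod length ns)"
      by (auto simp: orbit_def eq)
    moreover have "(i + n) mod length ns < length ns"
      using i by (intro mod_less_divisor) auto
    ultimately show "x \<in> set ns"
      using nth_mem by blast
  next
    fix x assume "x \<in> set ns"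
    then obtain k where k: "k < length ns" "x = ns ! k"
      by (auto simp: in_set_conv_nth)
    have "(i + (length ns - i + k)) mod length ns = k"
      using i k by simp
    with k have "x = apply (cycle ns ^ (length ns - i + k)) a"
      by (simp only: eq)
    then show "x \<in> orbit (cycle ns) a"
      by (auto simp: orbit_def)
  qed
qed

lemma affected_cycle:
  assumes "distinct ns" "length ns \<ge> 2"
  shows "affected (cycle ns) = set ns"
proof (intro subset_antisym subsetI)
  fix a assume "a \<in> affected (cycle ns)"
  then show "a \<in> set ns"
    using apply_cycle_notin[of a ns] by (auto simp: in_affected)
next
  fix a assume a: "a \<in> set ns"
  \<comment> \<open>A fixed point has a singleton orbit, but by \<open>orbit_cycle\<close> the orbit
    of \<open>a\<close> is all of \<open>set ns\<close>.\<close>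
  have "card (set ns) \<noteq> 1"
    using assms distinct_card[of ns] by simp
  then show "a \<in> affected (cycle ns)"
    using orbit_cycle[OF assms(1) a] not_in_affected_iff_orbit_eq_singleton[of a "cycle ns"]
    by auto
qed

lemma thoma_character_cycle:
  assumes "distinct ns" "length ns \<ge> 2"
  shows "thoma_character \<alpha> \<beta> (cycle ns) = of_real (thoma_cycle_value \<alpha> \<beta> (length ns))"
proof -
  have "orbit (cycle ns) ` affected (cycle ns) = {set ns}"
  proof -
    have "orbit (cycle ns) ` set ns = (\<lambda>_. set ns) ` set ns"
      using assms by (intro image_cong refl orbit_cycle)
    with assms show ?thesis
      by (auto simp: affected_cycle image_constant_conv)
  qed
  then show ?thesis
    using assms by (simp add: thoma_character_def distinct_card)
qed

lemma thoma_character_one: "thoma_character \<alpha> \<beta> 1 = 1"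
  by (simp add: thoma_character_def)

section \<open>Positive definiteness and the polynomial inequality\<close>

text \<open>With an arbitrary finite index set, the Gram matrix below can be indexed by options of
  pairs instead of initial segments of the naturals.\<close>

lemma positive_definite_finite:
  fixes z :: "'i \<Rightarrow> real"
  assumes f: "positive_definite f" and I: "finite I"
  shows "0 \<le> Re (\<Sum>i\<in>I. \<Sum>j\<in>I. of_real (z i) * f (rinf_star (r i) * r j) * of_real (z j))"
proof -
  obtain h where h: "bij_betw h {..<card I} I"
    using ex_bij_betw_nat_finite[OF I] by (auto simp: atLeast0LessThan)
  have "0 \<le> Re (\<Sum>i<card I. \<Sum>j<card I.
      cnj (of_real (z (h i))) * f (rinf_star (r (h i)) * r (h j)) * of_real (z (h j)))"
    using f[unfolded positive_definite_def hermitian_nonneg_def, rule_format, of "card I" "r \<circ> h"]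
    by (elim conjE allE[of _ "\<lambda>i. of_real (z (h i))"]) (simp only: comp_apply)
  also have "(\<Sum>i<card I. \<Sum>j<card I.
      cnj (of_real (z (h i))) * f (rinf_star (r (h i)) * r (h j)) * of_real (z (h j))) =
    (\<Sum>i\<in>I. \<Sum>j\<in>I. of_real (z i) * f (rinf_star (r i) * r j) * of_real (z j))"
    by (simp add: sum.reindex_bij_betw[OF h, symmetric])
  finally show ?thesis .
qed

text \<open>
  The vector \<open>p(O)\<xi>\<close> is replaced by an average over \<open>t < N\<close>: the \<open>j\<close>-th power of \<open>O\<close> becomes a
  cycle on 0 and \<open>j\<close> fresh points, the set of fresh points being disjoint for different pairs
  \<open>(j, t)\<close>.  Then only the \<open>N\<close> diagonal terms per \<open>j\<close> spoil the Gram matrix, which is of lower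
  order than its \<open>N\<^sup>2\<close> other terms.
\<close>

lemma quasicycle_polynomial_bound:
  fixes p m :: "nat \<Rightarrow> real" and \<rho> :: real
  assumes central: "central f" and pd: "positive_definite f"
    and cyc: "\<And>ns. distinct ns \<Longrightarrow> ns \<noteq> [] \<Longrightarrow>
      f (perm_matrix (cycle ns)) = of_real (m (length ns - 1))"
    and quasi: "\<And>ns. distinct ns \<Longrightarrow> 0 \<in> set ns \<Longrightarrow>
      f (perm_matrix (cycle ns) * eps {0}) = of_real (\<rho> ^ length ns)"
  shows "\<rho> * (\<Sum>j\<le>d. p j * \<rho> ^ j)\<^sup>2 \<le> (\<Sum>j\<le>d. \<Sum>k\<le>d. p j * p k * m (j + k))"
proof -
  define P where "P = (\<Sum>j\<le>d. p j * \<rho> ^ j)"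
  define A where "A = (\<Sum>j\<le>d. \<Sum>k\<le>d. p j * p k * m (j + k))"
  \<comment> \<open>The diagonal error: \<open>rinf_star (g x) * g x = 1\<close> gives
    \<open>m 0\<close>, where the pattern of the other entries would give
    \<open>m (2 * j)\<close>.\<close>
  define D where "D = (\<Sum>j\<le>d. (p j)\<^sup>2 * (m 0 - m (2 * j)))"
  \<comment> \<open>Injectivity of the nested pairing makes the points fresh, and \<open>Suc\<close>
    keeps them away from 0.\<close>
  define pts where "pts = (\<lambda>(j, t). map (\<lambda>i. Suc (prod_encode (prod_encode (j, t), i))) [0..<j])"
  define g where "g x = perm_matrix (cycle (0 # pts x))" for x
  have pts_length: "length (pts x) = fst x" for x
    by (simp add: pts_def split_beta)
  have pts_distinct: "distinct (pts x)" and pts_0: "0 \<notin> set (pts x)" for x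
    by (auto simp: pts_def split_beta distinct_map inj_on_def prod_encode_eq)
  have pts_disjoint: "set (pts x) \<inter> set (pts y) = {}" if "x \<noteq> y" for x y
    using that by (auto simp: pts_def split_beta prod_eq_iff prod_encode_eq)
  have star_g: "rinf_star (g x) = perm_matrix (cycle (0 # rev (pts x)))" for x
    by (simp add: g_def rinf_star_perm_matrix inverse_cycle_Cons)
  have f1: "f 1 = of_real (m 0)"
    using cyc[of "[0]"] by (simp add: perm_matrix_1)
  have gg: "f (rinf_star (g x) * g y) = of_real (m (fst x + fst y) +
      (if x = y then m 0 - m (2 * fst x) else 0))" for x y
  proof (cases "x = y")
    case True
    have "rinf_star (g x) * g x = 1"
      by (simp add: g_def rinf_star_perm_matrix perm_matrix_1 flip: perm_matrix_times)
    with True f1 show ?thesis by (simp add: mult_2)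
  next
    case False
    have "rinf_star (g x) * g y = perm_matrix (cycle (0 # pts y @ rev (pts x)))"
      by (simp only: star_g) (simp only: g_def cycle_Cons_append perm_matrix_times)
    moreover have "distinct (0 # pts y @ rev (pts x))"
      using False pts_disjoint[of x y] by (auto simp: pts_distinct pts_0)
    ultimately show ?thesis
      using False cyc[of "0 # pts y @ rev (pts x)"] by (simp add: pts_length add.commute)
  qed
  have ge: "f (rinf_star (g x) * eps {0}) = of_real (\<rho> ^ Suc (fst x))" for x
    using quasi[of "0 # rev (pts x)"] by (simp add: star_g pts_distinct pts_0 pts_length)
  have eg: "f (rinf_star (eps {0}) * g x) = of_real (\<rho> ^ Suc (fst x))" for x
  proof -
    have "f (rinf_star (eps {0}) * g x) = f (g x * eps {0})"
      using central by (simp add: central_def rinf_star_eps)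
    then show ?thesis
      using quasi[of "0 # pts x"] by (simp add: g_def pts_distinct pts_0 pts_length)
  qed
  have ee: "f (rinf_star (eps {0}) * eps {0}) = of_real \<rho>"
    using quasi[of "[0]"] by (simp add: rinf_star_eps eps_times_eps perm_matrix_1)
  have main: "0 \<le> real N * (A - \<rho> * P\<^sup>2) + D" if "N > 0" for N
  proof -
    define J where "J = {..d} \<times> {..<N}"
    \<comment> \<open>\<open>None\<close> stands for \<open>eps {0}\<close>. Its weight completes
      the square: the terms involving \<open>None\<close> add up to
      \<open>- \<rho> * (real N * P)\<^sup>2\<close>.\<close>
    define z :: "(nat \<times> nat) option \<Rightarrow> real" where "z = case_option (- (real N * P)) (p \<circ> fst)"
    define r where "r = case_option (eps {0}) g"
    have [simp]: "finite J" by (simp add: J_def)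
    have sJ: "(\<Sum>x\<in>J. h (fst x)) = real N * (\<Sum>j\<le>d. h j)" for h :: "nat \<Rightarrow> real"
    proof -
      have "(\<Sum>x\<in>J. h (fst x)) = (\<Sum>j\<le>d. \<Sum>t<N. h j)"
        unfolding sum.cartesian_product J_def by (simp add: split_beta)
      then show ?thesis
        by (simp add: sum_distrib_left)
    qed
    have sP: "(\<Sum>x\<in>J. p (fst x) * \<rho> ^ Suc (fst x)) = real N * (\<rho> * P)"
      by (subst sJ) (simp add: P_def sum_distrib_left mult_ac)
    have sA: "(\<Sum>x\<in>J. \<Sum>y\<in>J. p (fst x) * m (fst x + fst y) * p (fst y)) = (real N)\<^sup>2 * A"
    proof -
      have "(\<Sum>x\<in>J. \<Sum>y\<in>J. p (fst x) * m (fst x + fst y) * p (fst y)) =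
          (\<Sum>x\<in>J. real N * (\<Sum>k\<le>d. p (fst x) * m (fst x + k) * p k))"
        by (intro sum.cong refl, subst sJ) simp
      also have "\<dots> = real N * (\<Sum>j\<le>d. real N * (\<Sum>k\<le>d. p j * m (j + k) * p k))"
        by (rule sJ)
      finally show ?thesis
        by (simp add: A_def sum_distrib_left power2_eq_square mult_ac)
    qed
    have "0 \<le> Re (\<Sum>i\<in>insert None (Some ` J). \<Sum>j\<in>insert None (Some ` J).
        of_real (z i) * f (rinf_star (r i) * r j) * of_real (z j))"
      by (intro positive_definite_finite pd) simp
    also have "\<dots> = z None * \<rho> * z None + 2 * z None * (\<Sum>x\<in>J. p (fst x) * \<rho> ^ Suc (fst x))
        + (\<Sum>x\<in>J. \<Sum>y\<in>J. p (fst x) * m (fst x + fst y) * p (fst y))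
        + (\<Sum>x\<in>J. (p (fst x))\<^sup>2 * (m 0 - m (2 * fst x)))"
    proof -
      let ?T = "\<lambda>i j. of_real (z i) * f (rinf_star (r i) * r j) * of_real (z j)"
      have NN: "?T None None = of_real (z None * \<rho> * z None)"
        by (simp add: r_def ee)
      have NS: "?T None (Some x) = of_real (z None * (p (fst x) * \<rho> ^ Suc (fst x)))"
        and SN: "?T (Some x) None = of_real (z None * (p (fst x) * \<rho> ^ Suc (fst x)))" for x
        by (simp_all add: r_def z_def eg ge)
      have SS: "?T (Some x) (Some y) = of_real (p (fst x) * m (fst x + fst y) * p (fst y)
          + (if x = y then (p (fst x))\<^sup>2 * (m 0 - m (2 * fst x)) else 0))" for x y
        by (simp add: r_def z_def gg power2_eq_square algebra_simps)
      have diag: "(\<Sum>x\<in>J. \<Sum>y\<in>J. if x = y then h x else 0) = (\<Sum>x\<in>J. h x)"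
        for h :: "nat \<times> nat \<Rightarrow> real"
        by (intro sum.cong refl) simp
      have split: "(\<Sum>i\<in>insert None (Some ` J). \<Sum>j\<in>insert None (Some ` J). T i j) =
          T None None + (\<Sum>x\<in>J. T None (Some x)) + (\<Sum>x\<in>J. T (Some x) None)
          + (\<Sum>x\<in>J. \<Sum>y\<in>J. T (Some x) (Some y))"
        for T :: "(nat \<times> nat) option \<Rightarrow> (nat \<times> nat) option \<Rightarrow> complex"
        by (simp add: sum.reindex sum.distrib add.assoc)
      show ?thesis
        unfolding split NN NS SN SS of_real_sum[symmetric] of_real_add[symmetric] Re_complex_of_real
        by (simp only: sum.distrib diag sum_distrib_left[symmetric] mult_2 distrib_right add.assoc)
    qed
    also have "\<dots> = (real N)\<^sup>2 * (A - \<rho> * P\<^sup>2) + real N * D"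
      unfolding sP sA by (subst sJ) (simp add: z_def D_def power2_eq_square algebra_simps)
    also have "\<dots> = real N * (real N * (A - \<rho> * P\<^sup>2) + D)"
      by (simp add: power2_eq_square algebra_simps)
    finally show ?thesis
      using \<open>N > 0\<close> by (simp add: zero_le_mult_iff)
  qed
  have "\<rho> * P\<^sup>2 \<le> A"
  proof (rule ccontr)
    assume "\<not> \<rho> * P\<^sup>2 \<le> A"
    then have neg: "\<rho> * P\<^sup>2 - A > 0" by simp
    \<comment> \<open>A negative slope in \<open>main\<close> outweighs the constant
      \<open>D\<close> once \<open>N\<close> is large.\<close>
    then obtain N where N: "real N * (\<rho> * P\<^sup>2 - A) > \<bar>D\<bar>"
      using reals_Archimedean3 by blast
    then have "N > 0"
      by (cases N) auto
    with main[of N] N show False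
      by (simp add: algebra_simps)
  qed
  then show ?thesis
    by (simp add: P_def A_def)
qed

section \<open>Moments of the Thoma measure\<close>

lemma thoma_sequences_le_one:
  assumes "thoma_sequences \<alpha> \<beta>"
  shows "\<alpha> i \<le> 1" "\<beta> i \<le> 1"
proof -
  have "a i \<le> suminf a" if "summable a" "\<And>i. 0 \<le> a i" for a :: "nat \<Rightarrow> real"
    using sum_le_suminf[OF that(1), of "{i}"] that(2) by simp
  with assms have "\<alpha> i \<le> suminf \<alpha>" "\<beta> i \<le> suminf \<beta>" "0 \<le> suminf \<alpha>" "0 \<le> suminf \<beta>"
      "suminf \<alpha> + suminf \<beta> \<le> 1"
    by (auto simp: thoma_sequences_def intro!: suminf_nonneg)
  then show "\<alpha> i \<le> 1" "\<beta> i \<le> 1"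
    by linarith+
qed

text \<open>Both sides integrate \<open>Q\<close> against the measure with masses
  \<open>\<alpha> i\<close> at \<open>\<alpha> i\<close>, \<open>\<beta> i\<close> at
  \<open>- \<beta> i\<close> and \<open>\<gamma>\<close> at 0: its moment of order
  \<open>n > 0\<close> is Thoma's value on cycles of length \<open>n + 1\<close>, and its total mass
  is 1.\<close>

lemma thoma_quadratic_form:
  fixes p :: "nat \<Rightarrow> real" and d :: nat
  assumes thoma: "thoma_sequences \<alpha> \<beta>"
  defines "\<gamma> \<equiv> 1 - suminf \<alpha> - suminf \<beta>"
  defines "Q \<equiv> \<lambda>x. (\<Sum>j\<le>d. p j * x ^ j)\<^sup>2"
  shows "(\<Sum>j\<le>d. \<Sum>k\<le>d. p j * p k *
      (if j + k = 0 then 1 else thoma_cycle_value \<alpha> \<beta> (Suc (j + k)))) =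
    suminf (\<lambda>i. \<alpha> i * Q (\<alpha> i)) + suminf (\<lambda>i. \<beta> i * Q (- \<beta> i)) + \<gamma> * Q 0"
    and "summable (\<lambda>i. \<alpha> i * Q (\<alpha> i))" and "summable (\<lambda>i. \<beta> i * Q (- \<beta> i))"
proof -
  have pos: "0 \<le> \<alpha> i" "0 \<le> \<beta> i" for i
    using thoma by (auto simp: thoma_sequences_def)
  have summ: "summable \<alpha>" "summable \<beta>" and le1: "suminf \<alpha> + suminf \<beta> \<le> 1"
    using thoma by (auto simp: thoma_sequences_def)
  \<comment> \<open>Weights \<open>a\<close> and points \<open>s\<close> are kept apart because the
    masses \<open>\<beta> i\<close> sit at \<open>- \<beta> i\<close>.\<close>
  have summ_pow: "summable (\<lambda>i. a i * s i ^ k)"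
    if a: "summable a" "\<And>i. 0 \<le> a i" "\<And>i. \<bar>s i\<bar> \<le> 1" for a s :: "nat \<Rightarrow> real" and k
    using a by (intro summable_comparison_test'[OF a(1), of 0])
      (auto simp: abs_mult power_abs intro!: mult_left_le power_le_one)
  note bound = thoma_sequences_le_one[OF thoma]
  have Q_eq: "Q x = (\<Sum>j\<le>d. \<Sum>k\<le>d. p j * p k * x ^ (j + k))" for x
    by (simp add: Q_def power2_eq_square sum_product power_add mult_ac)
  have sums_Q: "(\<lambda>i. a i * Q (s i)) sums (\<Sum>j\<le>d. \<Sum>k\<le>d. p j * p k * suminf (\<lambda>i. a i * s i ^ (j + k)))"
    if "summable a" "\<And>i. 0 \<le> a i" "\<And>i. \<bar>s i\<bar> \<le> 1" for a s :: "nat \<Rightarrow> real"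
  proof -
    have "(\<lambda>i. \<Sum>j\<le>d. \<Sum>k\<le>d. p j * p k * (a i * s i ^ (j + k))) sums
        (\<Sum>j\<le>d. \<Sum>k\<le>d. p j * p k * suminf (\<lambda>i. a i * s i ^ (j + k)))"
      by (intro sums_sum sums_mult summable_sums summ_pow that)
    then show ?thesis
      by (simp add: Q_eq sum_distrib_left mult_ac)
  qed
  note \<alpha> = sums_Q[of \<alpha> \<alpha>, OF summ(1) pos(1)]
  note \<beta> = sums_Q[of \<beta> "\<lambda>i. - \<beta> i", OF summ(2) pos(2)]
  have s\<alpha>: "(\<lambda>i. \<alpha> i * Q (\<alpha> i)) sums (\<Sum>j\<le>d. \<Sum>k\<le>d. p j * p k * suminf (\<lambda>i. \<alpha> i * \<alpha> i ^ (j + k)))"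
    by (intro \<alpha>) (simp add: pos bound)
  have s\<beta>: "(\<lambda>i. \<beta> i * Q (- \<beta> i)) sums
      (\<Sum>j\<le>d. \<Sum>k\<le>d. p j * p k * suminf (\<lambda>i. \<beta> i * (- \<beta> i) ^ (j + k)))"
    by (intro \<beta>) (simp add: pos bound)
  \<comment> \<open>Since \<open>0 ^ 0 = 1\<close>, the atom at 0 contributes only for
    \<open>n = 0\<close>, where it completes the mass to 1. The sign in Thoma's formula is absorbed
    into \<open>(- \<beta> i) ^ n\<close>.\<close>
  have val: "(if n = 0 then 1 else thoma_cycle_value \<alpha> \<beta> (Suc n)) =
      suminf (\<lambda>i. \<alpha> i * \<alpha> i ^ n) + suminf (\<lambda>i. \<beta> i * (- \<beta> i) ^ n) + \<gamma> * 0 ^ n" for n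
  proof (cases "n = 0")
    case False
    have "summable (\<lambda>i. \<beta> i * \<beta> i ^ n)"
      using summ_pow[OF summ(2) pos(2), of \<beta> n] by (simp add: pos bound)
    from suminf_mult[OF this, of "(-1) ^ n"] False show ?thesis
      by (simp add: thoma_cycle_value_def power_minus[of "\<beta> _"] mult_ac)
  qed (simp add: \<gamma>_def)
  show "summable (\<lambda>i. \<alpha> i * Q (\<alpha> i))" "summable (\<lambda>i. \<beta> i * Q (- \<beta> i))"
    using s\<alpha> s\<beta> by (auto simp: sums_iff)
  show "(\<Sum>j\<le>d. \<Sum>k\<le>d. p j * p k *
      (if j + k = 0 then 1 else thoma_cycle_value \<alpha> \<beta> (Suc (j + k)))) =
    suminf (\<lambda>i. \<alpha> i * Q (\<alpha> i)) + suminf (\<lambda>i. \<beta> i * Q (- \<beta> i)) + \<gamma> * Q 0"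
  proof -
    have "\<gamma> * Q 0 = (\<Sum>j\<le>d. \<Sum>k\<le>d. p j * p k * (\<gamma> * 0 ^ (j + k)))"
      by (simp only: Q_eq[of 0] sum_distrib_left mult.left_commute[of \<gamma>])
    then show ?thesis
      unfolding val sums_unique[OF s\<alpha>, symmetric] sums_unique[OF s\<beta>, symmetric]
      by (simp only: distrib_left sum.distrib)
  qed
qed

section \<open>Detecting an atom by polynomials\<close>

text \<open>All but finitely many terms are below \<open>\<rho> / 2\<close> in absolute value, so a
  minimum over the others suffices. By \<open>\<delta> \<le> \<rho>\<close>, the point 0 and all
  negative points are also at distance at least \<open>\<delta>\<close> from
  \<open>\<rho>\<close>.\<close>

lemma null_sequence_gap:
  fixes a :: "nat \<Rightarrow> real"
  assumes "a \<longlonglongrightarrow> 0" "0 < \<rho>" "\<And>i. a i \<noteq> \<rho>"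
  obtains \<delta> where "0 < \<delta>" "\<delta> \<le> \<rho>" "\<And>i. \<delta> \<le> \<bar>a i - \<rho>\<bar>"
proof -
  obtain n where n: "\<bar>a i\<bar> < \<rho> / 2" if "i \<ge> n" for i
    using LIMSEQ_D[OF assms(1), of "\<rho> / 2"] assms(2) by auto
  define \<delta> where "\<delta> = Min (insert (\<rho> / 2) ((\<lambda>i. \<bar>a i - \<rho>\<bar>) ` {..<n}))"
  have half: "\<delta> \<le> \<rho> / 2"
    unfolding \<delta>_def by (intro Min_le) auto
  show thesis
  proof
    show "0 < \<delta>"
      using assms(2,3) by (simp add: \<delta>_def)
    show "\<delta> \<le> \<rho>"
      using half assms(2) by simp
    fix i
    show "\<delta> \<le> \<bar>a i - \<rho>\<bar>"
    proof (cases "i < n")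
      case True
      then show ?thesis by (auto simp: \<delta>_def intro!: Min_le)
    next
      case False
      with n[of i] half show ?thesis by linarith
    qed
  qed
qed

text \<open>
  The polynomials \<open>(1 - (x - \<rho>)\<^sup>2 / 4) ^ n\<close> decrease to the indicator of \<open>\<rho>\<close> on \<open>[-1, 1]\<close>.
\<close>

lemma terms_if_polynomial_bound:
  fixes \<rho> :: real
  assumes thoma: "thoma_sequences \<alpha> \<beta>" and rho: "0 < \<rho>" "\<rho> \<le> 1"
    and bound: "\<And>d p. \<rho> * (\<Sum>j\<le>d. p j * \<rho> ^ j)\<^sup>2 \<le> (\<Sum>j\<le>d. \<Sum>k\<le>d. p j * p k *
      (if j + k = 0 then 1 else thoma_cycle_value \<alpha> \<beta> (Suc (j + k))))"
  shows "\<rho> \<in> terms \<alpha>"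
proof (rule ccontr)
  assume "\<rho> \<notin> terms \<alpha>"
  with rho have ne: "\<alpha> i \<noteq> \<rho>" for i
    by (auto simp: terms_def)
  have pos: "0 \<le> \<alpha> i" "0 \<le> \<beta> i" for i
    using thoma by (auto simp: thoma_sequences_def)
  have summ: "summable \<alpha>" "summable \<beta>" and le1: "suminf \<alpha> + suminf \<beta> \<le> 1"
    using thoma by (auto simp: thoma_sequences_def)
  note le = thoma_sequences_le_one[OF thoma]
  obtain \<delta> where \<delta>: "0 < \<delta>" "\<delta> \<le> \<rho>" "\<And>i. \<delta> \<le> \<bar>\<alpha> i - \<rho>\<bar>"
    using null_sequence_gap[OF summable_LIMSEQ_zero[OF summ(1)] rho(1) ne] by metis
  \<comment> \<open>The squared base polynomial takes this value at distance \<open>\<delta>\<close>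
    from \<open>\<rho>\<close>.\<close>
  define q where "q = (1 - \<delta>\<^sup>2 / 4)\<^sup>2"
  have \<delta>2: "\<delta>\<^sup>2 \<le> 1"
    using \<delta> rho by (simp add: power_le_one)
  have q: "0 \<le> q" "q < 1"
    using \<delta> \<delta>2 by (auto simp: q_def power2_less_1_iff abs_if)
  have "\<rho> \<le> q ^ n" for n
  proof -
    \<comment> \<open>The base is \<open>1 - (x - \<rho>)\<^sup>2 / 4\<close>, expanded in powers of
      \<open>x\<close>.\<close>
    define pol where "pol = ([:1 - \<rho>\<^sup>2 / 4, \<rho> / 2, - 1 / 4:] :: real poly) ^ n"
    define Q where "Q x = (\<Sum>j\<le>degree pol. coeff pol j * x ^ j)\<^sup>2" for x
    have Q_eq: "Q x = ((1 - (x - \<rho>)\<^sup>2 / 4)\<^sup>2) ^ n" for x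
    proof -
      have "poly [:1 - \<rho>\<^sup>2 / 4, \<rho> / 2, - 1 / 4:] x = 1 - (x - \<rho>)\<^sup>2 / 4"
        by (simp add: power2_eq_square field_simps)
      then show ?thesis
        unfolding Q_def poly_altdef[symmetric] pol_def poly_power
        by (simp only: power_mult[symmetric] mult.commute)
    qed
    have Q_le: "Q x \<le> q ^ n" if "\<delta> \<le> \<bar>x - \<rho>\<bar>" "\<bar>x\<bar> \<le> 1" for x
    proof -
      have "\<delta>\<^sup>2 \<le> (x - \<rho>)\<^sup>2"
        using that(1) \<delta>(1) by (simp add: abs_le_square_iff[symmetric])
      \<comment> \<open>This keeps the base nonnegative, as monotonicity of its powers
        requires.\<close>
      moreover have "(x - \<rho>)\<^sup>2 \<le> 2\<^sup>2"
        using that(2) rho by (intro power2_le_iff_abs_le[THEN iffD2]) auto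
      ultimately show ?thesis
        unfolding Q_eq q_def by (intro power_mono) auto
    qed
    have Q\<alpha>: "Q (\<alpha> i) \<le> q ^ n" and Q\<beta>: "Q (- \<beta> i) \<le> q ^ n" and Q0: "Q 0 \<le> q ^ n" for i
      using \<delta> pos[of i] le[of i] rho by (auto intro!: Q_le)
    note * = thoma_quadratic_form[OF thoma, where d = "degree pol" and p = "coeff pol",
        folded Q_def]
    have "\<rho> = \<rho> * Q \<rho>"
      by (simp add: Q_eq)
    also have "\<dots> \<le> suminf (\<lambda>i. \<alpha> i * Q (\<alpha> i)) + suminf (\<lambda>i. \<beta> i * Q (- \<beta> i))
        + (1 - suminf \<alpha> - suminf \<beta>) * Q 0"
      using bound[of "coeff pol" "degree pol"] unfolding *(1) Q_def[symmetric] .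
    also have "\<dots> \<le> suminf (\<lambda>i. \<alpha> i * q ^ n) + suminf (\<lambda>i. \<beta> i * q ^ n) + (1 - suminf \<alpha> - suminf \<beta>) * q ^ n"
      using le1 by (intro add_mono suminf_le * mult_left_mono Q\<alpha> Q\<beta> Q0 pos summable_mult2 summ) auto
    \<comment> \<open>The masses add up to 1.\<close>
    also have "\<dots> = q ^ n"
      by (simp add: suminf_mult2[symmetric] summ algebra_simps)
    finally show ?thesis .
  qed
  then have "\<rho> \<le> 0"
    using LIMSEQ_power_zero[of q] q by (intro LIMSEQ_le_const) auto
  with rho show False by simp
qed

theorem theorem8:
  fixes f :: "rinf \<Rightarrow> complex" and \<rho> :: real and \<alpha> \<beta> :: "nat \<Rightarrow> real"
  assumes f: "indecomposable_finite_character f"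
    and rho: "0 \<le> \<rho>" "\<rho> \<le> 1"
    and rho_quasicycle:
      "\<And>ns A. ns \<noteq> [] \<Longrightarrow> distinct ns \<Longrightarrow> A \<subseteq> set ns \<Longrightarrow> A \<noteq> {} \<Longrightarrow>
         f (perm_matrix (cycle ns) * eps A) = of_real (\<rho> ^ card (set ns))"
    and thoma: "thoma_parameters (\<lambda>p. f (perm_matrix p)) \<alpha> \<beta>"
  shows "\<rho> \<in> terms \<alpha> \<union> {0} \<and>
    (\<forall>lam k A. \<rho> = lam \<and> 1 \<le> k \<and> A \<subseteq> {1..k} \<longrightarrow>
       f (perm_matrix (cycle [1..<Suc k]) * eps A) =
         (if A \<noteq> {} then of_real (lam ^ k)
          else thoma_character \<alpha> \<beta> (cycle [1..<Suc k])))"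
proof (intro conjI allI impI)
  have seqs: "thoma_sequences \<alpha> \<beta>" and \<chi>: "f (perm_matrix p) = thoma_character \<alpha> \<beta> p" for p
    using thoma by (auto simp: thoma_parameters_def dest: fun_cong)
  \<comment> \<open>The index is the length minus one. Index 0 is set apart because a one-point
    cycle is the identity, with value 1, while \<open>thoma_cycle_value\<close> at length 1 is
    \<open>suminf \<alpha> + suminf \<beta>\<close>, which may be smaller.\<close>
  let ?m = "\<lambda>n. if n = 0 then 1 else thoma_cycle_value \<alpha> \<beta> (Suc n)"
  have cyc: "f (perm_matrix (cycle ns)) = of_real (?m (length ns - 1))"
    if "distinct ns" "ns \<noteq> []" for ns
  proof (cases "length ns \<ge> 2")
    case True
    with that show ?thesis by (auto simp: \<chi> thoma_character_cycle)
  next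
    case False
    with that obtain a where "ns = [a]"
      by (cases ns rule: cycle.cases) auto
    then show ?thesis by (simp add: \<chi> thoma_character_one)
  qed
  have quasi: "f (perm_matrix (cycle ns) * eps {0}) = of_real (\<rho> ^ length ns)"
    if "distinct ns" "0 \<in> set ns" for ns
    using rho_quasicycle[of ns "{0}"] that by (cases "ns = []") (auto simp: distinct_card)
  have fc: "central f" "positive_definite f"
    using f by (auto simp: indecomposable_finite_character_def)
  have "\<rho> \<in> terms \<alpha>" if "0 < \<rho>"
    by (rule terms_if_polynomial_bound[OF seqs that rho(2)])
      (rule quasicycle_polynomial_bound[OF fc cyc quasi])
  with rho(1) show "\<rho> \<in> terms \<alpha> \<union> {0}"
    by fastforce
  fix lam and k :: nat and A :: "nat set"
  assume *: "\<rho> = lam \<and> 1 \<le> k \<and> A \<subseteq> {1..k}"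
  have "eps {} = 1"
    by (rule rinf_eqI) (simp add: entry_eps entry_one_eq_1_iff del: One_nat_def)
  with * rho_quasicycle[of "[1..<Suc k]" A] \<chi>
  show "f (perm_matrix (cycle [1..<Suc k]) * eps A) =
      (if A \<noteq> {} then of_real (lam ^ k) else thoma_character \<alpha> \<beta> (cycle [1..<Suc k]))"
    by (auto simp: atLeastLessThanSuc_atLeastAtMost simp del: upt_Suc)
qed

end
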